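(* Let $\mathcal C=\mathcal C(I=\{1,2\},\mathcal X,r,(A^X)_{X\in\mathcal X})$ be a connected semi-Cartan graph of rank two such that $|\mathcal X|$ is finite. Let $X\in\mathcal X$ and let $n$ be the smallest positive integer with $(r_2r_1)^n(X)=X$. Let $(c_k)_{k\ge1}$ be the characteristic sequence of $\mathcal C$ with respect to $X$ and $1$, and let $l=6n-\sum_{i=1}^{2n}c_i$. The following are equivalent: (1) $\mathcal C$ is a finite Cartan graph; (2) $l>0$, $l\mid 12$, $(c_1,c_2,\dots,c_{12n/l})\in\mathcal A^+$, and $(c_k)_{k\ge1}=(c_1,c_2,\dots,c_{12n/l})^\infty$. In this case $12n/l=|\boldsymbol\Delta^{X\,\mathrm{re}}_{+}|=t^X_{12}$.
   Context: $\mathbb N_0=\{0,1,2,\dots\}$. Let $I$ be a non-empty finite set and $(\alpha_i)_{i\in I}$ the standard basis of $\mathbb Z^I$. A generalized Cartan matrix is $A=(a_{ij})_{i,j\in I}\in\mathbb Z^{I\times I}$ with $a_{ii}=2$, $a_{jk}\le0$ for $j\ne k$, and $a_{ij}=0\Rightarrow a_{ji}=0$. A semi-Cartan graph $\mathcal C(I,\mathcal X,r,(A^X)_{X\in\mathcal X})$ consists of a non-empty set $\mathcal X$ (points), a map $r:I\times\mathcal X\to\mathcal X$, $r_i:=r(i,\cdot)$, and generalized Cartan matrices $A^X=(a^X_{ij})_{i,j\in I}$ such that $r_i^2=\mathrm{id}_{\mathcal X}$ and $a^X_{ij}=a^{r_i(X)}_{ij}$ for all $X\in\mathcal X$, $i,j\in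 I$. Its rank is $|I|$. It is connected if the graph on $\mathcal X$ with edges between $X\ne Y$ whenever $r_i(X)=Y$ for some $i\in I$ is connected. Let $s^X_i\in\mathrm{Aut}(\mathbb Z^I)$, $s^X_i(\alpha_j)=\alpha_j-a^X_{ij}\alpha_i$. In the category with objects $\mathcal X$, morphisms $\mathrm{Hom}(X,Y)=\{(Y,f,X)\mid f\in\mathrm{End}(\mathbb Z^I)\}$ and composition $(Z,g,Y)\circ(Y,f,X)=(Z,gf,X)$, let $\mathcal W(\mathcal C)$ be the smallest subcategory containing all $(r_i(X),s^X_i,X)$. The set of real roots at $X$ is $\boldsymbol\Delta^{X\,\mathrm{re}}=\{w\alpha_i\mid i\in I,\ w\text{ a morphism of }\mathcal W(\mathcal C)\text{ with target }X\}$, and $\boldsymbol\Delta^{X\,\mathrm{re}}_+=\boldsymbol\Delta^{X\,\mathrm{re}}\cap\mathbb N_0^I$ is the set of positive (real) roots; elements of $\boldsymbol\Delta^{X\,\mathrm{re}}\cap-\mathbb N_0^I$ are negative. Put $t^X_{ij}=|\boldsymbol\Delta^{X\,\mathrm{re}}\cap(\mathbb N_0\alpha_i+\mathbb N_0\alpha_j)|$. $\mathcal C$ is finite if $\boldsymbol\Delta^{X\,\mathrm{re}}$ is finite for all $X\in\mathcal X$. $\mathcal C$ is a Cartan graph if for all $X\in\mathcal X$ the set $\boldsymbol\Delta^{X\,\mathrm{re}}$ consists of positive and negative roots, and for all $X\in\mathcal X$, $i,j\in I$ with $t^X_{ij}<\infty$ one has $(r_ir_j)^{t^X_{ij}}(X)=X$.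 For $|I|=2$, $X\in\mathcal X$, $i\in I$ and $j\in I\setminus\{i\}$, the characteristic sequence of $\mathcal C$ with respect to $X$ and $i$ is the sequence $(c_k)_{k\ge1}$ of non-negative integers with $c_{2k+1}=-a_{ij}^{(r_jr_i)^k(X)}$ and $c_{2k+2}=-a_{ji}^{r_i(r_jr_i)^k(X)}$ for all $k\ge0$. $\mathcal A^+$ is the smallest subset of $\bigcup_{n\ge2}\mathbb N_0^n$ such that $(0,0)\in\mathcal A^+$ and, if $(c_1,\dots,c_n)\in\mathcal A^+$ and $1<i\le n$, then $(c_1,\dots,c_{i-2},c_{i-1}+1,1,c_i+1,c_{i+1},\dots,c_n)\in\mathcal A^+$. For a finite sequence $(v_1,\dots,v_n)$, $(v_1,\dots,v_n)^\infty=(u_k)_{k\ge1}$ is the sequence with $u_{mn+i}=v_i$ for $1\le i\le n$, $m\ge0$. *)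

theory Defs
  imports "HOL-Analysis.Cartesian_Space" "HOL-Library.Extended_Nat"
begin

text \<open>
  The index set is the universe of a type of class \<open>finite\<close>, and \<open>int ^ 'i\<close> is the lattice
  with standard basis \<open>simple_root i\<close>.
\<close>

abbreviation simple_root :: "'i::finite \<Rightarrow> int ^ 'i"
  where "simple_root i \<equiv> axis i 1"

definition gen_cartan_matrix :: "int ^ 'i ^ 'i::finite \<Rightarrow> bool"
  where "gen_cartan_matrix A \<longleftrightarrow>
    (\<forall>i. A $ i $ i = 2) \<and>
    (\<forall>j k. j \<noteq> k \<longrightarrow> A $ j $ k \<le> 0) \<and>
    (\<forall>i j. A $ i $ j = 0 \<longrightarrow> A $ j $ i = 0)"

text \<open>The values of \<open>rmap\<close> and \<open>cmat\<close> outside the carrier \<open>points\<close> are irrelevant.\<close>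

record ('i, 'x) graph_data =
  points :: "'x set"
  rmap :: "'i::finite \<Rightarrow> 'x \<Rightarrow> 'x"
  cmat :: "'x \<Rightarrow> int ^ 'i ^ 'i"

definition semi_cartan_graph :: "('i::finite, 'x) graph_data \<Rightarrow> bool"
  where "semi_cartan_graph C \<longleftrightarrow>
    points C \<noteq> {} \<and>
    (\<forall>i. \<forall>X\<in>points C. rmap C i X \<in> points C) \<and>
    (\<forall>X\<in>points C. gen_cartan_matrix (cmat C X)) \<and>
    (\<forall>i. \<forall>X\<in>points C. rmap C i (rmap C i X) = X) \<and>
    (\<forall>X\<in>points C. \<forall>i j. cmat C X $ i $ j = cmat C (rmap C i X) $ i $ j)"

text \<open>Since every \<open>rmap C i\<close> is an involution, the edge relation is symmetric.\<close>

definition exchange_edges :: "('i::finite, 'x) graph_data \<Rightarrow> ('x \<times> 'x) set"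
  where "exchange_edges C =
    {(X, Y). X \<in> points C \<and> Y \<in> points C \<and> X \<noteq> Y \<and> (\<exists>i. rmap C i X = Y)}"

definition connected_graph :: "('i::finite, 'x) graph_data \<Rightarrow> bool"
  where "connected_graph C \<longleftrightarrow>
    (\<forall>X\<in>points C. \<forall>Y\<in>points C. (X, Y) \<in> (exchange_edges C)\<^sup>*)"

text \<open>The additive extension of \<open>\<alpha>\<^sub>j \<mapsto> \<alpha>\<^sub>j - a\<^sub>i\<^sub>j \<alpha>\<^sub>i\<close>.\<close>

definition simple_refl :: "('i::finite, 'x) graph_data \<Rightarrow> 'x \<Rightarrow> 'i \<Rightarrow> int ^ 'i \<Rightarrow> int ^ 'i"
  where "simple_refl C X i v =
    (\<Sum>j\<in>UNIV. v $ j *s (simple_root j - cmat C X $ i $ j *s simple_root i))"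

text \<open>
  A triple \<open>(Y, f, X)\<close> is a morphism with source \<open>X\<close> and target \<open>Y\<close>.
\<close>

inductive_set weyl_groupoid ::
  "('i::finite, 'x) graph_data \<Rightarrow> ('x \<times> (int ^ 'i \<Rightarrow> int ^ 'i) \<times> 'x) set"
  for C :: "('i, 'x) graph_data"
  where
    ident: "X \<in> points C \<Longrightarrow> (X, id, X) \<in> weyl_groupoid C"
  | gen: "X \<in> points C \<Longrightarrow> (rmap C i X, simple_refl C X i, X) \<in> weyl_groupoid C"
  | comp: "(Z, g, Y) \<in> weyl_groupoid C \<Longrightarrow> (Y, f, X) \<in> weyl_groupoid C
      \<Longrightarrow> (Z, g \<circ> f, X) \<in> weyl_groupoid C"

definition real_roots :: "('i::finite, 'x) graph_data \<Rightarrow> 'x \<Rightarrow> (int ^ 'i) set"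
  where "real_roots C X = {w (simple_root i) | i w Y. (X, w, Y) \<in> weyl_groupoid C}"

definition nonneg_vecs :: "(int ^ 'i::finite) set"
  where "nonneg_vecs = {v. \<forall>i. 0 \<le> v $ i}"

definition pos_roots :: "('i::finite, 'x) graph_data \<Rightarrow> 'x \<Rightarrow> (int ^ 'i) set"
  where "pos_roots C X = real_roots C X \<inter> nonneg_vecs"

definition neg_roots :: "('i::finite, 'x) graph_data \<Rightarrow> 'x \<Rightarrow> (int ^ 'i) set"
  where "neg_roots C X = real_roots C X \<inter> uminus ` nonneg_vecs"

definition plane_roots :: "('i::finite, 'x) graph_data \<Rightarrow> 'x \<Rightarrow> 'i \<Rightarrow> 'i \<Rightarrow> (int ^ 'i) set"
  where "plane_roots C X i j = real_roots C X \<inter>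
    {int a *s simple_root i + int b *s simple_root j | a b. True}"

definition t_num :: "('i::finite, 'x) graph_data \<Rightarrow> 'x \<Rightarrow> 'i \<Rightarrow> 'i \<Rightarrow> enat"
  where "t_num C X i j =
    (if finite (plane_roots C X i j) then enat (card (plane_roots C X i j)) else \<infinity>)"

definition finite_graph :: "('i::finite, 'x) graph_data \<Rightarrow> bool"
  where "finite_graph C \<longleftrightarrow> (\<forall>X\<in>points C. finite (real_roots C X))"

definition cartan_graph :: "('i::finite, 'x) graph_data \<Rightarrow> bool"
  where "cartan_graph C \<longleftrightarrow>
    semi_cartan_graph C \<and>
    (\<forall>X\<in>points C. real_roots C X = pos_roots C X \<union> neg_roots C X) \<and>
    (\<forall>X\<in>points C. \<forall>i j. t_num C X i j < \<infinity> \<longrightarrow>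
      ((rmap C i \<circ> rmap C j) ^^ the_enat (t_num C X i j)) X = X)"

text \<open>
  For an index type with exactly the two elements \<open>i \<noteq> j\<close>. The sequence is indexed from \<open>1\<close>;
  its value at \<open>0\<close> is junk. As \<open>a\<^sub>i\<^sub>j \<le> 0\<close> for \<open>i \<noteq> j\<close>, nothing is lost by \<open>nat\<close>.
\<close>

definition char_seq :: "('i::finite, 'x) graph_data \<Rightarrow> 'x \<Rightarrow> 'i \<Rightarrow> 'i \<Rightarrow> nat \<Rightarrow> nat"
  where "char_seq C X i j k =
    (if odd k
     then nat (- cmat C (((rmap C j \<circ> rmap C i) ^^ (k div 2)) X) $ i $ j)
     else nat (- cmat C (rmap C i (((rmap C j \<circ> rmap C i) ^^ (k div 2 - 1)) X)) $ j $ i))"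

inductive_set A_plus :: "nat list set"
  where
    base: "[0, 0] \<in> A_plus"
  | insert: "us @ [a, b] @ vs \<in> A_plus \<Longrightarrow> us @ [a + 1, 1, b + 1] @ vs \<in> A_plus"

text \<open>Indexed from \<open>1\<close>, for a non-empty list.\<close>

definition periodic_seq :: "'a list \<Rightarrow> nat \<Rightarrow> 'a"
  where "periodic_seq v k = v ! ((k - 1) mod length v)"

end

theory Submission
  imports Defs
begin

text \<open>
  Walking from \<open>X\<close> along \<open>r\<^sub>1, r\<^sub>2, r\<^sub>1, \<dots>\<close> in both directions gives points \<open>X\<^sub>k\<close>, \<open>k \<in> \<int>\<close>, a bi-infinite
  characteristic sequence \<open>c\<^sub>k\<close> of period \<open>2n\<close>, and vectors with
  \<open>\<beta>\<^sub>k\<^sub>+\<^sub>1 = c\<^sub>k \<beta>\<^sub>k - \<beta>\<^sub>k\<^sub>-\<^sub>1\<close>, \<open>\<beta>\<^sub>-\<^sub>1 = -\<alpha>\<^sub>2\<close>, \<open>\<beta>\<^sub>0 = \<alpha>\<^sub>1\<close>. Put \<open>D(j,k) = det(\<beta>\<^sub>j, \<beta>\<^sub>k)\<close>. The real roots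
  at \<open>X\<^sub>m\<close> are the vectors \<open>\<plusminus>\<beta>\<^sub>k\<close> written in the basis \<open>\<beta>\<^sub>m, -\<beta>\<^sub>m\<^sub>-\<^sub>1\<close>, with coordinates
  \<open>D(m-1,k)\<close> and \<open>D(m,k)\<close>.

  If all roots are positive or negative and there are finitely many, then the sequence \<open>D(m,\<cdot>)\<close>
  cannot change sign without vanishing, and it does vanish; its first zero \<open>m + N\<close> forces
  \<open>\<beta>\<^sub>m\<^sub>+\<^sub>N = -\<beta>\<^sub>m\<close>, and coherence at neighbouring points propagates this to all \<open>m\<close> with the same
  \<open>N\<close>. Conversely such a half period makes all \<open>D(j,k)\<close> with \<open>j < k < j + N\<close> positive by the
  Pluecker relation. Having half period \<open>N\<close> means that \<open>c\<close> is \<open>N\<close>-periodic and that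
  \<open>(c\<^sub>0,\<dots>,c\<^sub>N\<^sub>-\<^sub>1)\<close> turns \<open>(-\<alpha>\<^sub>2, \<alpha>\<^sub>1)\<close> into \<open>(\<alpha>\<^sub>2, -\<alpha>\<^sub>1)\<close> through non-negative vectors, which
  characterises \<open>\<A>\<^sup>+\<close>: a vector of maximal height is the sum of its neighbours, so its entry is 1
  and can be removed. Members of \<open>\<A>\<^sup>+\<close> of length \<open>N\<close> have sum \<open>3N - 6\<close>; comparing the periods
  \<open>N\<close> and \<open>2n\<close> gives \<open>N l = 12 n\<close>.
\<close>

section \<open>A geometric description of \<open>\<A>\<^sup>+\<close>\<close>

text \<open>
  One step of a run maps \<open>(\<beta>\<^sub>k\<^sub>-\<^sub>1, \<beta>\<^sub>k)\<close> to \<open>(\<beta>\<^sub>k, c\<^sub>k \<beta>\<^sub>k - \<beta>\<^sub>k\<^sub>-\<^sub>1)\<close>, one coordinate at a time; the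
  final vector of a run is exempt from non-negativity.
\<close>

fun run :: "int \<Rightarrow> int \<Rightarrow> nat list \<Rightarrow> int \<times> int" where
  "run x y [] = (x, y)"
| "run x y (a # cs) = run y (int a * y - x) cs"

fun nonneg_run :: "int \<Rightarrow> int \<Rightarrow> nat list \<Rightarrow> bool" where
  "nonneg_run x y [] \<longleftrightarrow> True"
| "nonneg_run x y (a # cs) \<longleftrightarrow> 0 \<le> y \<and> nonneg_run y (int a * y - x) cs"

text \<open>Position \<open>k\<close> holds a coordinate of the vector with index
  \<open>k - 1\<close>, since the sequences start at index -1.\<close>

fun rec_seq :: "(nat \<Rightarrow> nat) \<Rightarrow> int \<Rightarrow> int \<Rightarrow> nat \<Rightarrow> int" where
  "rec_seq c x y 0 = x"
| "rec_seq c x y (Suc 0) = y"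
| "rec_seq c x y (Suc (Suc k)) = int (c k) * rec_seq c x y (Suc k) - rec_seq c x y k"

lemma run_append:
  "run x y (us @ vs) = run (fst (run x y us)) (snd (run x y us)) vs"
  by (induction us arbitrary: x y) auto

lemma nonneg_run_append:
  "nonneg_run x y (us @ vs) \<longleftrightarrow>
    nonneg_run x y us \<and> nonneg_run (fst (run x y us)) (snd (run x y us)) vs"
  by (induction us arbitrary: x y) auto

lemma run_map_upt: "run x y (map c [0..<k]) = (rec_seq c x y k, rec_seq c x y (Suc k))"
  by (induction k) (simp_all add: run_append)

lemma nonneg_run_map_upt:
  "nonneg_run x y (map c [0..<N]) \<longleftrightarrow> (\<forall>k<N. 0 \<le> rec_seq c x y (Suc k))"
  by (induction N) (auto simp: nonneg_run_append run_map_upt less_Suc_eq)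

text \<open>The runs from \<open>(0, 1)\<close> and \<open>(-1, 0)\<close> follow the two
  coordinates of the vectors starting with \<open>-\<alpha>\<^sub>2, \<alpha>\<^sub>1\<close>; the
  end values say that the last two vectors are
  \<open>\<alpha>\<^sub>2, -\<alpha>\<^sub>1\<close>.\<close>

definition half_turn :: "nat list \<Rightarrow> bool" where
  "half_turn cs \<longleftrightarrow> run 0 1 cs = (0, -1) \<and> run (-1) 0 cs = (1, 0) \<and>
    nonneg_run 0 1 cs \<and> nonneg_run (-1) 0 cs"

text \<open>The insertion adds one vector, the sum of its two neighbours, and keeps all others. For
  the same reason it does not affect non-negativity.\<close>

lemma run_insert: "run x y (us @ [a + 1, 1, b + 1] @ vs) = run x y (us @ [a, b] @ vs)"
  by (simp add: run_append algebra_simps)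

lemma nonneg_run_insert:
  "nonneg_run x y (us @ [a + 1, 1, b + 1] @ vs) \<longleftrightarrow> nonneg_run x y (us @ [a, b] @ vs)"
  by (auto simp add: nonneg_run_append algebra_simps)

lemma half_turn_insert:
  "half_turn (us @ [a + 1, 1, b + 1] @ vs) \<longleftrightarrow> half_turn (us @ [a, b] @ vs)"
  unfolding half_turn_def run_insert nonneg_run_insert ..

lemma A_plus_half_turn: "cs \<in> A_plus \<Longrightarrow> half_turn cs"
proof (induction rule: A_plus.induct)
  case base
  show ?case by (simp add: half_turn_def)
next
  case (insert us a b vs)
  then show ?case using half_turn_insert by blast
qed

lemma A_plus_sum_list: "cs \<in> A_plus \<Longrightarrow> sum_list cs + 6 = 3 * length cs"
  by (induction rule: A_plus.induct) auto

lemma rec_seq_det: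
  "rec_seq c 0 1 k * rec_seq c (-1) 0 (Suc k) - rec_seq c 0 1 (Suc k) * rec_seq c (-1) 0 k = 1"
  by (induction k) (simp_all add: algebra_simps)

text \<open>The entry 1 sits where the height of the vectors along the run is last maximal.\<close>

lemma half_turn_entry_one:
  fixes c :: "nat \<Rightarrow> nat"
  assumes ht: "half_turn (map c [0..<N])"
  shows "N = 2 \<and> c 0 = 0 \<and> c 1 = 0 \<or>
    (\<exists>i. Suc (Suc i) < N \<and> 0 < c i \<and> c (Suc i) = 1 \<and> 0 < c (Suc (Suc i)))"
proof -
  define P where "P = rec_seq c 0 1"
  define Q where "Q = rec_seq c (-1) 0"
  define h where "h k = P k + Q k" for k
  have P: "P N = 0" "P (Suc N) = -1" and Q: "Q N = 1" "Q (Suc N) = 0"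
    and nn: "\<And>k. k < N \<Longrightarrow> 0 \<le> P (Suc k)" "\<And>k. k < N \<Longrightarrow> 0 \<le> Q (Suc k)"
    using ht by (auto simp: half_turn_def run_map_upt nonneg_run_map_upt P_def Q_def)
  have P0: "P 0 = 0" "P (Suc 0) = 1" "Q 0 = -1" "Q (Suc 0) = 0"
    by (simp_all add: P_def Q_def)
  have Prec: "P (Suc (Suc k)) = int (c k) * P (Suc k) - P k"
    and Qrec: "Q (Suc (Suc k)) = int (c k) * Q (Suc k) - Q k" for k
    by (simp_all add: P_def Q_def)
  have hrec: "h (Suc (Suc k)) + h k = int (c k) * h (Suc k)" for k
    by (simp add: h_def Prec Qrec algebra_simps)
  have hpos: "0 < h (Suc k)" if "k < N" for k
  proof -
    have "P (Suc k) \<noteq> 0 \<or> Q (Suc k) \<noteq> 0"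
      using rec_seq_det[of c "Suc k"] unfolding P_def Q_def by auto
    then show ?thesis using nn[OF that] by (auto simp: h_def)
  qed
  have "N \<noteq> 0" using P(2) P0(2) by (intro notI) simp
  moreover have "N \<noteq> 1" using P(1) P0(2) by (intro notI) simp
  ultimately consider "N = 2" | "3 \<le> N" by linarith
  then show ?thesis
  proof cases
    case 1
    have "P (Suc (Suc 0)) = 0" "Q (Suc (Suc (Suc 0))) = 0" "Q (Suc (Suc 0)) = 1"
      using P Q 1 by (simp_all add: numeral_2_eq_2)
    then have "c 0 = 0" "c 1 = 0" using Prec[of 0] Qrec[of 1] P0 by auto
    then show ?thesis using 1 by simp
  next
    case 2
    \<comment> \<open>\<open>P 3 = c 1 * c 0 - 1\<close>, so non-negativity excludes
      \<open>c 0 = 0\<close>.\<close>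
    have "0 \<le> P (Suc (Suc (Suc 0)))" using nn(1)[of 2] 2 by (simp add: numeral_2_eq_2)
    then have c0: "0 < c 0"
      unfolding Prec P0 by (cases "c 0 = 0") auto
    then have h2: "2 \<le> h 2" using P0 by (simp add: h_def numeral_2_eq_2 Prec Qrec)
    have h1: "h 1 = 1" "h N = 1" "h (Suc N) = -1" using P0 P Q by (simp_all add: h_def)
    define M where "M = Max (h ` {1..N})"
    have hM: "h k \<le> M" if "k \<in> {1..N}" for k using that by (simp add: M_def)
    have "M \<in> h ` {1..N}" unfolding M_def using 2 by (intro Max_in) auto
    then have ne: "{k \<in> {1..N}. h k = M} \<noteq> {}" by auto
    define k where "k = Max {k \<in> {1..N}. h k = M}"
    have fin: "finite {k \<in> {1..N}. h k = M}" by simp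
    have k: "k \<in> {1..N}" "h k = M" using Max_in[OF fin ne] by (auto simp: k_def)
    have kmax: "j \<le> k" if "j \<in> {1..N}" "h j = M" for j
      using Max_ge[OF fin] that unfolding k_def by blast
    have "2 \<le> M" using hM[of 2] 2 h2 by auto
    then have "k \<noteq> 1" "k \<noteq> N" using k h1 by auto
    then have kb: "1 < k" "k < N" using k by auto
    then obtain i where i: "k = Suc (Suc i)" by (metis less_imp_Suc_add add.commute plus_1_eq_Suc add_Suc)
    \<comment> \<open>As \<open>k\<close> is the last maximum, the right neighbour is strictly
      lower; this makes the coefficient smaller than 2.\<close>
    have l: "h (Suc k) < h k" using hM[of "Suc k"] kmax[of "Suc k"] kb k by fastforce
    have l': "h (Suc i) \<le> h k" using hM[of "Suc i"] i kb k by auto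
    have p: "0 < h (Suc k)" "0 < h (Suc i)" "0 < h k" using hpos[of k] hpos[of i] hpos[of "Suc i"] kb i by auto
    have e: "h (Suc k) + h (Suc i) = int (c (Suc i)) * h k" using hrec[of "Suc i"] i by simp
    have "int (c (Suc i)) * h k < 2 * h k" "0 * h k < int (c (Suc i)) * h k"
      unfolding e[symmetric] using l l' p by linarith+
    then have "int (c (Suc i)) < 2" "0 < int (c (Suc i))"
      using p(3) mult_less_cancel_right_pos by blast+
    then have c1: "c (Suc i) = 1" by linarith
    \<comment> \<open>For \<open>i = 0\<close> the height \<open>h 0 = -1\<close> is not positive,
      so the earlier bound on \<open>c 0\<close> takes over.\<close>
    have "0 < c i"
    proof (cases i)
      case 0
      then show ?thesis using c0 by simp
    next
      case (Suc j)
      then have "0 < h i" using hpos[of j] kb i by auto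
      then have "0 < int (c i) * h (Suc i)" using hrec[of i] p i by simp
      then show ?thesis by (cases "c i = 0") auto
    qed
    moreover have "0 < c k"
    proof -
      \<comment> \<open>Just after \<open>N\<close> the height is -1, which the maximal height, at
        least 2, outweighs.\<close>
      have "-1 \<le> h (Suc (Suc k))"
        using hpos[of "Suc k"] h1 kb by (cases "Suc k = N") fastforce+
      then have "0 < int (c k) * h (Suc k)" using hrec[of k] \<open>2 \<le> M\<close> k by simp
      then show ?thesis by (cases "c k = 0") auto
    qed
    ultimately show ?thesis using c1 i kb by blast
  qed
qed

text \<open>Removing the entry 1 undoes an insertion, and the shorter list is again a half turn
  because \<open>half_turn_insert\<close> is an equivalence.\<close>

lemma half_turn_A_plus: "half_turn cs \<Longrightarrow> cs \<in> A_plus"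
proof (induction "length cs" arbitrary: cs rule: less_induct)
  case less
  have "map ((!) cs) [0..<length cs] = cs" by (rule map_nth)
  then have "length cs = 2 \<and> cs ! 0 = 0 \<and> cs ! 1 = 0 \<or>
    (\<exists>i. Suc (Suc i) < length cs \<and> 0 < cs ! i \<and> cs ! Suc i = 1 \<and> 0 < cs ! Suc (Suc i))"
    using half_turn_entry_one[of "(!) cs" "length cs"] less.prems by simp
  then show ?case
  proof (elim disjE exE conjE)
    assume "length cs = 2" "cs ! 0 = 0" "cs ! 1 = 0"
    then have "cs = [0, 0]" by (auto simp: numeral_2_eq_2 length_Suc_conv)
    then show ?thesis using A_plus.base by simp
  next
    fix i assume i: "Suc (Suc i) < length cs" "0 < cs ! i" "cs ! Suc i = 1" "0 < cs ! Suc (Suc i)"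
    define a where "a = cs ! i - 1"
    define b where "b = cs ! Suc (Suc i) - 1"
    define us where "us = take i cs"
    define vs where "vs = drop (Suc (Suc (Suc i))) cs"
    have "cs = take i cs @ cs ! i # cs ! Suc i # cs ! Suc (Suc i) # vs"
      using i(1) by (simp add: vs_def Cons_nth_drop_Suc id_take_nth_drop[symmetric])
    then have cs: "cs = us @ [a + 1, 1, b + 1] @ vs" using i by (simp add: a_def b_def us_def)
    then have "half_turn (us @ [a, b] @ vs)" using less.prems half_turn_insert by metis
    moreover have "length (us @ [a, b] @ vs) < length cs" by (simp add: cs)
    ultimately have "us @ [a, b] @ vs \<in> A_plus" using less.hyps by blast
    then show ?thesis unfolding cs by (rule A_plus.insert)
  qed
qed

section \<open>Bi-infinite recursions\<close>

text \<open>Read backwards the recursion has the same shape with reversed coefficients, so the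
  negative side is again a \<open>rec_seq\<close>, with the initial values swapped.\<close>

definition solution :: "(int \<Rightarrow> nat) \<Rightarrow> int \<Rightarrow> int \<Rightarrow> int \<Rightarrow> int" where
  "solution c x y k = (if -1 \<le> k then rec_seq (\<lambda>j. c (int j)) x y (nat (k + 1))
     else rec_seq (\<lambda>j. c (- int j - 1)) y x (nat (- k)))"

lemma solution_init [simp]: "solution c x y (-1) = x" "solution c x y 0 = y"
  by (simp_all add: solution_def)

lemma solution_rec: "solution c x y (k + 1) = int (c k) * solution c x y k - solution c x y (k - 1)"
proof (cases "0 \<le> k")
  case True
  then obtain j where "k = int j" using nonneg_int_cases by blast
  then show ?thesis by (simp add: solution_def nat_add_distrib)
next
  case False
  then obtain j where j: "k = - int j - 1"
    by (intro that[of "nat (- k - 1)"]) simp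
  have 1: "solution c x y (- int i) = rec_seq (\<lambda>j. c (- int j - 1)) y x i" for i
  proof (cases "i \<le> 1")
    case True
    then have "i = 0 \<or> i = 1" by auto
    then show ?thesis by (auto simp: solution_def)
  qed (simp add: solution_def)
  have "k + 1 = - int j" "k = - int (Suc j)" "k - 1 = - int (Suc (Suc j))" "c k = c (- int j - 1)"
    by (simp_all add: j)
  moreover have "rec_seq (\<lambda>j. c (- int j - 1)) y x j = int (c (- int j - 1)) *
      rec_seq (\<lambda>j. c (- int j - 1)) y x (Suc j) - rec_seq (\<lambda>j. c (- int j - 1)) y x (Suc (Suc j))"
    by simp
  ultimately show ?thesis by (simp only: 1)
qed

lemma solution_nat: "solution c x y (int k - 1) = rec_seq (\<lambda>j. c (int j)) x y k"
  by (simp add: solution_def)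

lemma recursion_unique:
  fixes f g :: "int \<Rightarrow> int" and c :: "int \<Rightarrow> nat"
  assumes f: "\<And>k. f (k + 1) = int (c k) * f k - f (k - 1)"
    and g: "\<And>k. g (k + 1) = int (c k) * g k - g (k - 1)"
    and "f m = g m" "f (m + 1) = g (m + 1)"
  shows "f k = g k"
proof -
  have "f k = g k \<and> f (k + 1) = g (k + 1)"
  proof (induction k rule: int_induct[where k = m])
    case base
    show ?case using assms by simp
  next
    case (step1 i)
    then show ?case using f[of "i + 1"] g[of "i + 1"] by simp
  next
    case (step2 i)
    then show ?case using f[of i] g[of i] by auto
  qed
  then show ?thesis ..
qed

lemma periodic_mult:
  fixes f :: "int \<Rightarrow> 'a"
  assumes "\<And>k. f (k + p) = f k"
  shows "f (k + s * p) = f k"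
proof (induction s rule: int_induct[where k = 0])
  case (step1 s)
  then show ?case using assms[of "k + s * p"] by (simp add: algebra_simps)
next
  case (step2 s)
  then show ?case using assms[of "k + (s - 1) * p"] by (simp add: algebra_simps)
qed simp

section \<open>Determinants of pairs of vectors, and half periods\<close>

definition cdet :: "(int \<Rightarrow> nat) \<Rightarrow> int \<Rightarrow> int \<Rightarrow> int" where
  "cdet c j k = solution c 0 1 j * solution c (-1) 0 k - solution c 0 1 k * solution c (-1) 0 j"

lemma cdet_m1: "cdet c (-1) k = solution c 0 1 k"
  and cdet_0: "cdet c 0 k = solution c (-1) 0 k"
  by (simp_all add: cdet_def)

lemma cdet_self [simp]: "cdet c k k = 0"
  by (simp add: cdet_def)

lemma cdet_antisym: "cdet c k j = - cdet c j k"
  by (simp add: cdet_def)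

lemma cdet_rec: "cdet c j (k + 1) = int (c k) * cdet c j k - cdet c j (k - 1)"
  unfolding cdet_def solution_rec by (simp add: algebra_simps)

lemma cdet_rec_left: "cdet c (j + 1) k = int (c j) * cdet c j k - cdet c (j - 1) k"
  unfolding cdet_def solution_rec by (simp add: algebra_simps)

lemma cdet_Suc [simp]: "cdet c k (k + 1) = 1"
proof (induction k rule: int_induct[where k = 0])
  case base
  show ?case using solution_rec[of c "-1" 0 0] by (simp add: cdet_def)
next
  case (step1 i)
  then show ?case using cdet_rec[of c "i + 1" "i + 1"] cdet_antisym[of c "i + 1" i] by simp
next
  case (step2 i)
  then show ?case using cdet_rec[of c i i] cdet_antisym[of c "i - 1" i] by simp
qed

lemma cdet_pred [simp]: "cdet c (k - 1) k = 1"
  using cdet_Suc[of c "k - 1"] by simp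

lemma cdet_Suc_left [simp]: "cdet c (k + 1) k = -1"
  using cdet_antisym[of c "k + 1" k] by simp

lemma cdet_pred_right [simp]: "cdet c k (k - 1) = -1"
  using cdet_antisym[of c k "k - 1"] by simp

lemma cdet_pluecker:
  "cdet c i j * cdet c k l - cdet c i k * cdet c j l + cdet c i l * cdet c j k = 0"
  by (simp add: cdet_def algebra_simps)

text \<open>The sign rule for all \<open>j\<close> says that the vectors change sign after
  \<open>N\<close> steps. Non-negativity is asked only in the window at \<open>X\<^sub>0\<close>, as
  in \<open>half_turn\<close>; positivity elsewhere is derived from it.\<close>

definition half_period :: "(int \<Rightarrow> nat) \<Rightarrow> nat \<Rightarrow> bool" where
  "half_period c N \<longleftrightarrow> 0 < N \<and> (\<forall>j k. cdet c j (k + int N) = - cdet c j k) \<and>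
     (\<forall>k\<in>{0..<int N}. 0 \<le> cdet c (-1) k \<and> 0 \<le> cdet c 0 k)"

lemma half_period_shift:
  assumes "half_period c N"
  shows "cdet c j (k + int N) = - cdet c j k" "cdet c (j + int N) k = - cdet c j k"
proof -
  show *: "cdet c j (k + int N) = - cdet c j k" for j k
    using assms by (simp add: half_period_def)
  show "cdet c (j + int N) k = - cdet c j k"
    using *[of k j] cdet_antisym[of c k j] cdet_antisym[of c k "j + int N"] by simp
qed

text \<open>Induction on \<open>k\<close> through
  \<open>D(x,k) D(j,k+1) = D(x,j) + D(x,k+1) D(j,k)\<close>, where \<open>x\<close> is -1 or 0,
  chosen such that \<open>D(x,j)\<close> is positive.\<close>

lemma half_period_cdet_pos_base:
  assumes hp: "half_period c N" and "0 \<le> j" "j < k" "k < int N"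
  shows "0 < cdet c j k"
proof -
  have "j + 1 \<le> k" using assms by simp
  then have "k < int N \<longrightarrow> 0 < cdet c j k"
  proof (induction k rule: int_ge_induct)
    case base
    show ?case by simp
  next
    case (step k)
    show ?case
    proof
      assume kN: "k + 1 < int N"
      then have IH: "0 < cdet c j k" using step by simp
      have nn: "0 \<le> cdet c x i" if "x = -1 \<or> x = 0" "0 \<le> i" "i < int N" for x i
        using hp that unfolding half_period_def by auto
      have "cdet c (-1) j * cdet c 0 (j+1) - cdet c (-1) (j+1) * cdet c 0 j = 1"
        using cdet_pluecker[of c "-1" 0 j "j+1"] cdet_Suc[of c "-1"] by simp
      then have "cdet c (-1) j \<noteq> 0 \<or> cdet c 0 j \<noteq> 0" by auto
      moreover have "0 \<le> cdet c (-1) j" "0 \<le> cdet c 0 j"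
        using nn[of _ j] assms step kN by auto
      ultimately obtain x where x: "x = -1 \<or> x = 0" "0 < cdet c x j"
        by (metis order_le_less)
      have "cdet c x k * cdet c j (k + 1) = cdet c x j + cdet c x (k + 1) * cdet c j k"
        using cdet_pluecker[of c x j k "k + 1"] by simp
      moreover have "0 \<le> cdet c x (k + 1) * cdet c j k"
        using nn[OF x(1), of "k + 1"] kN step assms IH by simp
      ultimately have "0 < cdet c x k * cdet c j (k + 1)" using x by linarith
      moreover have "0 \<le> cdet c x k" using nn[OF x(1), of k] kN step assms by simp
      ultimately show "0 < cdet c j (k + 1)" by (simp add: zero_less_mult_iff)
    qed
  qed
  then show ?thesis using assms by simp
qed

text \<open>Shifting both arguments by \<open>N\<close> changes the sign twice, so \<open>j\<close>
  can be moved into \<open>[0,N)\<close>. If \<open>k\<close> then lies outside,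
  \<open>D(j,k) = D(k-N,j)\<close> brings it back.\<close>

lemma half_period_cdet_pos:
  assumes hp: "half_period c N" and "j < k" "k < j + int N"
  shows "0 < cdet c j k"
proof -
  have N: "0 < N" using hp by (simp add: half_period_def)
  have "cdet c (i + (t + int N)) (l + (t + int N)) = cdet c (i + t) (l + t)" for i l t
    using half_period_shift(1)[OF hp, of "i + t + int N" "l + t"]
      half_period_shift(2)[OF hp, of "i + t" "l + t"]
    by (simp add: add.assoc)
  then have sh: "cdet c (i + s * int N) (l + s * int N) = cdet c i l" for i l s
    using periodic_mult[of "\<lambda>t. cdet c (i + t) (l + t)" "int N" 0 s] by simp
  define s where "s = j div int N"
  define j' where "j' = j mod int N"
  define k' where "k' = k - s * int N"
  have jj: "j = j' + s * int N" by (simp add: j'_def s_def)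
  have j': "0 \<le> j'" "j' < int N" using N by (simp_all add: j'_def)
  have k': "j' < k'" "k' < j' + int N" using assms jj by (simp_all add: k'_def)
  have "0 < cdet c j' k'"
  proof (cases "k' < int N")
    case True
    then show ?thesis using half_period_cdet_pos_base[OF hp] j' k' by simp
  next
    case False
    then have "0 < cdet c (k' - int N) j'" using half_period_cdet_pos_base[OF hp] j' k' by simp
    then show ?thesis
      using half_period_shift(2)[OF hp, of "k' - int N" j'] cdet_antisym[of c j' k'] by simp
  qed
  then show ?thesis using sh[of j' s k'] jj by (simp add: k'_def)
qed

lemma half_period_cdet_nonneg:
  assumes "half_period c N" and "j \<le> k" "k \<le> j + int N"
  shows "0 \<le> cdet c j k"
proof -
  consider "k = j" | "k = j + int N" | "j < k \<and> k < j + int N" using assms by linarith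
  then show ?thesis
    using half_period_shift(1)[OF assms(1), of j j] half_period_cdet_pos[OF assms(1), of j k]
    by cases auto
qed

text \<open>Moving \<open>k\<close> into the window by multiples of \<open>N\<close> costs a sign
  that is the same for all left arguments.\<close>

lemma half_period_cdet_coherent:
  assumes hp: "half_period c N"
  shows "\<exists>i\<in>{m..<m + int N}. (cdet c (m - 1) k = cdet c (m - 1) i \<and> cdet c m k = cdet c m i) \<or>
     (cdet c (m - 1) k = - cdet c (m - 1) i \<and> cdet c m k = - cdet c m i)"
proof -
  have N: "0 < N" using hp by (simp add: half_period_def)
  have sh: "\<exists>e\<in>{1, -1}. \<forall>j. cdet c j (i + s * int N) = e * cdet c j i" for i s
  proof (induction s rule: int_induct[where k = 0])
    case (step1 s)
    then obtain e where "e \<in> {1, -1}" "\<And>j. cdet c j (i + s * int N) = e * cdet c j i" by blast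
    moreover have "cdet c j (i + (s + 1) * int N) = - cdet c j (i + s * int N)" for j
      using half_period_shift(1)[OF hp, of j "i + s * int N"] by (simp add: algebra_simps)
    ultimately show ?case by (intro bexI[of _ "- e"]) auto
  next
    case (step2 s)
    then obtain e where "e \<in> {1, -1}" "\<And>j. cdet c j (i + s * int N) = e * cdet c j i" by blast
    moreover have "cdet c j (i + (s - 1) * int N) = - cdet c j (i + s * int N)" for j
      using half_period_shift(1)[OF hp, of j "i + (s - 1) * int N"] by (simp add: algebra_simps)
    ultimately show ?case by (intro bexI[of _ "- e"]) auto
  qed simp
  define i where "i = m + (k - m) mod int N"
  have "k = i + ((k - m) div int N) * int N" by (simp add: i_def)
  moreover have "i \<in> {m..<m + int N}" using N by (simp add: i_def)
  moreover obtain e where "e \<in> {1, -1}" "\<And>j. cdet c j (i + ((k - m) div int N) * int N) = e * cdet c j i"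
    using sh[of i "(k - m) div int N"] by blast
  ultimately show ?thesis by (intro bexI[of _ i]) auto
qed

text \<open>The recursions at \<open>k\<close> and \<open>k + N\<close> are compared;
  \<open>D(k-1,k+N) = -1\<close> can be cancelled.\<close>

lemma half_period_periodic:
  assumes hp: "half_period c N"
  shows "c (k + int N) = c k"
proof -
  have "int (c (k + int N)) * cdet c (k - 1) (k + int N) = int (c k) * cdet c (k - 1) (k + int N)"
    using cdet_rec[of c "k - 1" "k + int N"] cdet_rec[of c "k - 1" k]
      half_period_shift(1)[OF hp, of "k - 1" "k + 1"] half_period_shift(1)[OF hp, of "k - 1" "k - 1"]
      half_period_shift(1)[OF hp, of "k - 1" k]
    by (simp add: algebra_simps)
  moreover have "cdet c (k - 1) (k + int N) = -1"
    using half_period_shift(1)[OF hp, of "k - 1" k] by simp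
  ultimately show ?thesis by simp
qed

lemma half_turn_map_iff:
  "half_turn (map (\<lambda>k. c (int k)) [0..<N]) \<longleftrightarrow>
    cdet c (-1) (int N - 1) = 0 \<and> cdet c (-1) (int N) = -1 \<and>
    cdet c 0 (int N - 1) = 1 \<and> cdet c 0 (int N) = 0 \<and>
    (\<forall>k\<in>{0..<int N}. 0 \<le> cdet c (-1) k \<and> 0 \<le> cdet c 0 k)"
proof -
  have s: "rec_seq (\<lambda>j. c (int j)) x y (Suc k) = solution c x y (int k)" for x y k
    using solution_nat[of c x y "Suc k"] by simp
  have "(\<forall>k\<in>{0..<int N}. Pr k) \<longleftrightarrow> (\<forall>k<N. Pr (int k))" for Pr :: "int \<Rightarrow> bool"
    by (metis atLeastLessThan_iff nonneg_int_cases of_nat_0_le_iff of_nat_less_iff)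
  then show ?thesis
    unfolding half_turn_def run_map_upt nonneg_run_map_upt cdet_m1 cdet_0 s solution_nat
    by auto
qed

lemma half_period_A_plus:
  assumes hp: "half_period c N"
  shows "map (\<lambda>k. c (int k)) [0..<N] \<in> A_plus"
proof (rule half_turn_A_plus, unfold half_turn_map_iff, intro conjI)
  show "cdet c (-1) (int N - 1) = 0"
    using half_period_shift(1)[OF hp, of "-1" "-1"] by simp
  show "cdet c (-1) (int N) = -1"
    using half_period_shift(1)[OF hp, of "-1" 0] cdet_Suc[of c "-1"] by simp
  show "cdet c 0 (int N - 1) = 1"
    using half_period_shift(1)[OF hp, of 0 "-1"] cdet_Suc_left[of c "-1"] by simp
  show "cdet c 0 (int N) = 0"
    using half_period_shift(1)[OF hp, of 0 0] by simp
  show "\<forall>k\<in>{0..<int N}. 0 \<le> cdet c (-1) k \<and> 0 \<le> cdet c 0 k"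
    using hp by (simp add: half_period_def)
qed

text \<open>The half turn gives the sign change at the indices -1 and 0. As \<open>c\<close> is
  \<open>N\<close>-periodic, the shifted and the negated sequence satisfy the same recursion, so
  they agree everywhere.\<close>

lemma A_plus_half_period:
  assumes "map (\<lambda>k. c (int k)) [0..<N] \<in> A_plus" and per: "\<And>k. c (k + int N) = c k"
  shows "half_period c N"
proof -
  have ht: "half_turn (map (\<lambda>k. c (int k)) [0..<N])" using assms A_plus_half_turn by blast
  note h = ht[unfolded half_turn_map_iff]
  have sh: "cdet c x (k + int N) = - cdet c x k" if x: "x = -1 \<or> x = 0" for x k
  proof (rule recursion_unique[where c = c and m = "-1"
        and f = "\<lambda>k. cdet c x (k + int N)" and g = "\<lambda>k. - cdet c x k"])
    show "cdet c x (k + 1 + int N) = int (c k) * cdet c x (k + int N) - cdet c x (k - 1 + int N)" for k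
      using cdet_rec[of c x "k + int N"] per[of k] by (simp add: algebra_simps)
    show "- cdet c x (k + 1) = int (c k) * - cdet c x k - - cdet c x (k - 1)" for k
      using cdet_rec[of c x k] by simp
    show "cdet c x (-1 + int N) = - cdet c x (-1)"
      using h x cdet_Suc_left[of c "-1"] by (auto simp: algebra_simps)
    show "cdet c x (-1 + 1 + int N) = - cdet c x (-1 + 1)"
      using h x cdet_Suc[of c "-1"] by auto
  qed
  have "cdet c j (k + int N) = - cdet c j k" for j k
    using sh[of "-1" k] sh[of 0 k] unfolding cdet_m1 cdet_0 by (simp add: cdet_def algebra_simps)
  moreover have "0 < N" using h cdet_self[of c 0] by (cases "N = 0") (auto simp: cdet_m1 cdet_0)
  ultimately show ?thesis using h by (simp add: half_period_def)
qed

section \<open>Existence of a half period\<close>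

text \<open>Pigeonhole on the pairs of consecutive vectors at multiples of \<open>p\<close>: a
  repeated pair restarts the same recursion. This gives a full period, not yet a sign
  change.\<close>

lemma cdet_periodic_if_finite:
  assumes per: "\<And>k. c (k + int p) = c k" and "0 < p"
    and fin: "finite (range (\<lambda>k. (cdet c (-1) k, cdet c 0 k)))"
  shows "\<exists>T>0. \<forall>j k. cdet c j (k + int T) = cdet c j k"
proof -
  define V where "V k = (cdet c (-1) k, cdet c 0 k)" for k
  define F where "F i = (V (int i * int p), V (int i * int p + 1))" for i :: nat
  have "range F \<subseteq> range V \<times> range V" by (auto simp: F_def)
  moreover have "finite (range V)" using fin by (simp add: V_def[abs_def])
  ultimately have "finite (range F)" by (meson finite_SigmaI finite_subset)
  then have "\<not> inj F" using finite_imageD by blast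
  then obtain a b where ab: "a < b" "F a = F b" by (metis injI linorder_neqE_nat)
  define T where "T = (b - a) * p"
  have T: "int T = (int b - int a) * int p" using ab by (simp add: T_def of_nat_diff)
  have cT: "c (k + int T) = c k" for k
    unfolding T using per by (rule periodic_mult)
  have V: "V (k + int T) = V k" if "k = int a * int p \<or> k = int a * int p + 1" for k
    using ab that by (auto simp: F_def T algebra_simps)
  have sh: "cdet c x (k + int T) = cdet c x k" if x: "x = -1 \<or> x = 0" for x k
  proof (rule recursion_unique[where c = c and m = "int a * int p"
        and f = "\<lambda>k. cdet c x (k + int T)" and g = "cdet c x"])
    show "cdet c x (k + 1 + int T) = int (c k) * cdet c x (k + int T) - cdet c x (k - 1 + int T)" for k
      using cdet_rec[of c x "k + int T"] cT[of k] by (simp add: algebra_simps)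
  qed (use V x cdet_rec in \<open>auto simp: V_def\<close>)
  have "cdet c j (k + int T) = cdet c j k" for j k
    using sh[of "-1" k] sh[of 0 k] unfolding cdet_m1 cdet_0 by (simp add: cdet_def)
  moreover have "0 < T" using ab \<open>0 < p\<close> by (simp add: T_def)
  ultimately show ?thesis by blast
qed

text \<open>The full period \<open>T\<close> serves twice: it provides a zero of
  \<open>D(0,_)\<close>, and it carries results from non-negative to negative indices.\<close>

lemma half_period_exists:
  assumes per: "\<And>k. c (k + int p) = c k" and "0 < p"
    and fin: "finite (range (\<lambda>k. (cdet c (-1) k, cdet c 0 k)))"
    and coh: "\<And>m k. 0 \<le> cdet c (m - 1) k * cdet c m k"
  shows "\<exists>N. half_period c N"
proof -
  obtain T where T: "0 < T" and shT: "\<And>j k. cdet c j (k + int T) = cdet c j k"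
    using cdet_periodic_if_finite[OF per \<open>0 < p\<close> fin] by blast
  have coh1: "0 \<le> cdet c m k * cdet c (m + 1) k" for m k using coh[of "m + 1" k] by simp
  have coh2: "0 \<le> cdet c k m * cdet c k (m + 1)" for m k
    using coh1[of m k] cdet_antisym[of c k m] cdet_antisym[of c k "m + 1"] by simp
  define N where "N = (LEAST N. 0 < N \<and> cdet c 0 (int N) = 0)"
  have "0 < T \<and> cdet c 0 (int T) = 0" using T shT[of 0 0] by simp
  then have N: "0 < N" "cdet c 0 (int N) = 0"
    using LeastI[of "\<lambda>N. 0 < N \<and> cdet c 0 (int N) = 0"] unfolding N_def by blast+
  have minN: "N \<le> M" if "0 < M" "cdet c 0 (int M) = 0" for M
    using that Least_le[of "\<lambda>N. 0 < N \<and> cdet c 0 (int N) = 0"] unfolding N_def by blast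
  have pos: "0 < cdet c 0 (int (Suc j))" if "Suc j < N" for j
    using that
  proof (induction j)
    case 0
    show ?case using cdet_Suc[of c 0] by simp
  next
    case (Suc j)
    then have "0 < cdet c 0 (int (Suc j))" by simp
    moreover have "0 \<le> cdet c 0 (int (Suc j)) * cdet c 0 (int (Suc j) + 1)" by (rule coh2)
    ultimately have "0 \<le> cdet c 0 (int (Suc j) + 1)" by (simp add: zero_le_mult_iff)
    moreover have "cdet c 0 (int (Suc (Suc j))) \<noteq> 0" using minN[of "Suc (Suc j)"] Suc.prems by fastforce
    ultimately show ?case by (simp add: algebra_simps)
  qed
  have "N \<noteq> 1" using N cdet_Suc[of c 0] by auto
  then obtain N' where N': "N = Suc (Suc N')" using N(1) by (metis One_nat_def not0_implies_Suc not_gr_zero)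
  \<comment> \<open>\<open>D(-1,N) D(0,N-1) = -1\<close>, and a positive integer that divides -1 is
    1.\<close>
  have start: "cdet c 0 (int N - 1) = 1"
  proof -
    have "cdet c (-1) (int N) * cdet c 0 (int N - 1) = -1"
      using cdet_pluecker[of c "-1" 0 "int N - 1" "int N"] cdet_Suc[of c "-1"] N by simp
    moreover have "0 < cdet c 0 (int N - 1)" using pos[of N'] N' by simp
    ultimately show ?thesis by (metis minus_mult_left mult_minus_left pos_zmult_eq_1_iff mult.commute minus_minus)
  qed
  \<comment> \<open>\<open>D(m+1,m+N+1)\<close> is squeezed to 0: coherence with
    \<open>D(m,m+N+1) = -1\<close> bounds it above, coherence with \<open>D(m+1,m+N) = 1\<close>
    bounds it below.\<close>
  have step: "cdet c (m + 1) (m + 1 + int N) = 0 \<and> cdet c (m + 1) (m + int N) = 1"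
    if "cdet c m (m + int N) = 0" "cdet c m (m + int N - 1) = 1" for m
  proof -
    have 1: "cdet c (m + 1) (m + int N) = 1"
      using cdet_pluecker[of c m "m + 1" "m + int N - 1" "m + int N"] that by simp
    have "cdet c m (m + int N + 1) = -1" using cdet_rec[of c m "m + int N"] that by simp
    then have "cdet c (m + 1) (m + int N + 1) \<le> 0"
      using coh1[of m "m + int N + 1"] by simp
    moreover have "0 \<le> cdet c (m + 1) (m + int N + 1)"
      using coh2[of "m + 1" "m + int N"] 1 by simp
    ultimately show ?thesis using 1 by (simp add: algebra_simps)
  qed
  have nat: "cdet c (int i) (int i + int N) = 0 \<and> cdet c (int i) (int i + int N - 1) = 1" for i
  proof (induction i)
    case 0
    show ?case using N start by simp
  next
    case (Suc i)
    then show ?case using step[of "int i"] by (simp add: algebra_simps)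
  qed
  have shT': "cdet c (j + s * int T) (k + s * int T) = cdet c j k" for j k s
  proof -
    have "cdet c i (k + s * int T) = cdet c i k" for i k
      using shT by (rule periodic_mult)
    then show ?thesis using cdet_antisym by metis
  qed
  have all: "cdet c m (m + int N) = 0 \<and> cdet c m (m + int N - 1) = 1" for m
  proof -
    have "\<bar>m\<bar> \<le> \<bar>m\<bar> * int T" using T mult_left_mono[of 1 "int T" "\<bar>m\<bar>"] by simp
    then have "0 \<le> m + \<bar>m\<bar> * int T" by linarith
    then obtain i where i: "m + \<bar>m\<bar> * int T = int i" using nonneg_int_cases by blast
    show ?thesis
      using nat[of i] shT'[of m "\<bar>m\<bar>" "m + int N"] shT'[of m "\<bar>m\<bar>" "m + int N - 1"]
      unfolding i[symmetric] by (simp add: algebra_simps)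
  qed
  have sh: "cdet c x (m + int N) = - cdet c x m" for x m
  proof -
    have "cdet c (m + int N) m = 0" using all[of m] cdet_antisym[of c m "m + int N"] by simp
    moreover have "cdet c (m + int N) (m + 1) = -1"
      using all[of "m + 1"] cdet_antisym[of c "m + 1" "m + int N"] by (simp add: algebra_simps)
    ultimately show ?thesis using cdet_pluecker[of c x "m + int N" m "m + 1"] by simp
  qed
  have "0 \<le> cdet c (-1) k \<and> 0 \<le> cdet c 0 k" if k: "k \<in> {0..<int N}" for k
  proof (cases "k = 0")
    case True
    then show ?thesis using cdet_Suc[of c "-1"] by simp
  next
    case False
    then obtain i where i: "k = int (Suc i)" using k
      by (metis atLeastLessThan_iff nonneg_int_cases not0_implies_Suc of_nat_0)
    then have "0 < cdet c 0 k" using pos[of i] k by simp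
    then show ?thesis using coh[of 0 k] by (simp add: zero_le_mult_iff)
  qed
  then show ?thesis using N sh unfolding half_period_def by blast
qed

section \<open>Real roots of a semi-Cartan graph of rank two\<close>

text \<open>The label of the edge from \<open>X\<^sub>k\<close> to the next point; the edge back to
  the previous point has label \<open>alt_index (k + 1)\<close>.\<close>

definition alt_index :: "int \<Rightarrow> 2" where
  "alt_index k = (if even k then 1 else 2)"

lemma alt_index_neq [simp]: "alt_index (k + 1) \<noteq> alt_index k" "alt_index k \<noteq> alt_index (k + 1)"
  by (simp_all add: alt_index_def)

lemma alt_index_diff [simp]: "alt_index (k - 1) = alt_index (k + 1)"
  and alt_index_add2 [simp]: "alt_index (k + 2) = alt_index k"
  by (simp_all add: alt_index_def)

lemma alt_index_cases: "i = alt_index m \<or> i = alt_index (m + 1)"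
  using exhaust_2[of i] by (auto simp: alt_index_def)

lemma forall_alt_index: "(\<forall>i. Pr i) \<longleftrightarrow> Pr (alt_index m) \<and> Pr (alt_index (m + 1))"
  using alt_index_cases by metis

lemma sum_alt_index:
  fixes f :: "2 \<Rightarrow> 'a::comm_monoid_add"
  shows "sum f UNIV = f (alt_index m) + f (alt_index (m + 1))"
  unfolding sum_2 by (simp add: alt_index_def add.commute)

locale rank_two_graph =
  fixes C :: "(2, 'x) graph_data" and X :: 'x and n :: nat
  assumes graph: "semi_cartan_graph C" and connected: "connected_graph C"
    and base_point: "X \<in> points C"
    and n_pos: "0 < n" and n_period: "((rmap C 2 \<circ> rmap C 1) ^^ n) X = X"
begin

lemma rmap_in_points: "Y \<in> points C \<Longrightarrow> rmap C i Y \<in> points C"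
  and rmap_rmap: "Y \<in> points C \<Longrightarrow> rmap C i (rmap C i Y) = Y"
  and cmat_rmap: "Y \<in> points C \<Longrightarrow> cmat C (rmap C i Y) $ i $ j = cmat C Y $ i $ j"
  and cmat_diag: "Y \<in> points C \<Longrightarrow> cmat C Y $ i $ i = 2"
  and cmat_off_diag: "Y \<in> points C \<Longrightarrow> i \<noteq> j \<Longrightarrow> cmat C Y $ i $ j \<le> 0"
  using graph unfolding semi_cartan_graph_def gen_cartan_matrix_def by metis+

text \<open>Reducing the exponent modulo \<open>n\<close> gives a meaning to negative indices; the
  return of \<open>X\<close> after \<open>n\<close> rounds makes this agree with true
  powers.\<close>

definition pt :: "int \<Rightarrow> 'x" where
  "pt k = (let Y = ((rmap C 2 \<circ> rmap C 1) ^^ nat (k div 2 mod int n)) X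
           in if even k then Y else rmap C 1 Y)"

lemma funpow_mod_n: "((rmap C 2 \<circ> rmap C 1) ^^ (k mod n)) X = ((rmap C 2 \<circ> rmap C 1) ^^ k) X"
  using n_period by (rule funpow_mod_eq)

lemma pt_even: "pt (2 * int k) = ((rmap C 2 \<circ> rmap C 1) ^^ k) X"
  unfolding pt_def Let_def by (simp add: zmod_int[symmetric] funpow_mod_n)

lemma pt_odd: "pt (2 * int k + 1) = rmap C 1 (((rmap C 2 \<circ> rmap C 1) ^^ k) X)"
  unfolding pt_def Let_def by (simp add: zmod_int[symmetric] funpow_mod_n)

lemma pt_0 [simp]: "pt 0 = X"
  using pt_even[of 0] by simp

lemma pt_period: "pt (k + 2 * int n) = pt k"
proof -
  have "(k + 2 * int n) div 2 = k div 2 + int n" by simp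
  then show ?thesis by (simp add: pt_def)
qed

lemma pt_period_mult: "pt (k + s * (2 * int n)) = pt k"
  using pt_period by (rule periodic_mult)

lemma nonneg_representative:
  obtains k s where "m + s * (2 * int n) = int k"
proof -
  have "\<bar>m\<bar> \<le> \<bar>m\<bar> * (2 * int n)" using n_pos mult_left_mono[of 1 "2 * int n" "\<bar>m\<bar>"] by simp
  then have "0 \<le> m + \<bar>m\<bar> * (2 * int n)" by linarith
  then show ?thesis using that nonneg_int_cases by blast
qed

lemma pt_nat_in_points: "pt (int k) \<in> points C"
proof -
  have "((rmap C 2 \<circ> rmap C 1) ^^ i) X \<in> points C" for i
    by (induction i) (auto simp: base_point rmap_in_points)
  moreover obtain i where "int k = 2 * int i \<or> int k = 2 * int i + 1"
    by (metis evenE oddE of_nat_add of_nat_mult of_nat_numeral of_nat_1)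
  ultimately show ?thesis using pt_even pt_odd rmap_in_points by metis
qed

lemma pt_in_points [simp]: "pt m \<in> points C"
  using nonneg_representative[of m] pt_nat_in_points pt_period_mult by metis

lemma pt_Suc: "pt (m + 1) = rmap C (alt_index m) (pt m)"
proof -
  obtain k s where k: "m + s * (2 * int n) = int k" by (rule nonneg_representative)
  have "pt (int k + 1) = rmap C (alt_index (int k)) (pt (int k))"
  proof (cases "even k")
    case True
    then obtain i where "k = 2 * i" by blast
    then show ?thesis using pt_even[of i] pt_odd[of i] by (simp add: alt_index_def)
  next
    case False
    then obtain i where "k = 2 * i + 1" by (elim oddE)
    then show ?thesis using pt_even[of "Suc i"] pt_odd[of i]
      by (simp add: alt_index_def algebra_simps)
  qed
  moreover have "alt_index (int k) = alt_index m" unfolding k[symmetric] by (simp add: alt_index_def)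
  moreover have "pt (int k) = pt m" "pt (int k + 1) = pt (m + 1)"
    using pt_period_mult[of m s] pt_period_mult[of "m + 1" s] k by (simp_all add: algebra_simps)
  ultimately show ?thesis by simp
qed

lemma rmap_pt: "rmap C (alt_index m) (pt m) = pt (m + 1)"
  and rmap_pt_Suc: "rmap C (alt_index m) (pt (m + 1)) = pt m"
  and rmap_pt_pred: "rmap C (alt_index (m + 1)) (pt m) = pt (m - 1)"
proof -
  show "rmap C (alt_index m) (pt m) = pt (m + 1)" by (simp add: pt_Suc)
  show *: "rmap C (alt_index m) (pt (m + 1)) = pt m" for m by (simp add: pt_Suc rmap_rmap)
  show "rmap C (alt_index (m + 1)) (pt m) = pt (m - 1)" using *[of "m - 1"] by simp
qed

text \<open>Both edges at a point of the walk lead to points of the walk, so by connectedness it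
  visits everything.\<close>

lemma points_eq_pt: "Y \<in> points C \<Longrightarrow> \<exists>m. Y = pt m"
proof -
  assume "Y \<in> points C"
  then have "(X, Y) \<in> (exchange_edges C)\<^sup>*"
    using connected base_point by (simp add: connected_graph_def)
  then show ?thesis
  proof (induction rule: rtrancl_induct)
    case base
    show ?case by (metis pt_0)
  next
    case (step Y Z)
    then obtain m i where "Y = pt m" "rmap C i Y = Z" by (auto simp: exchange_edges_def)
    then show ?case using alt_index_cases[of i m] rmap_pt rmap_pt_pred by metis
  qed
qed

definition cs :: "int \<Rightarrow> nat" where
  "cs k = nat (- cmat C (pt k) $ alt_index k $ alt_index (k + 1))"

lemma cs_eq: "int (cs k) = - cmat C (pt k) $ alt_index k $ alt_index (k + 1)"
  using cmat_off_diag[of "pt k" "alt_index k" "alt_index (k + 1)"] by (simp add: cs_def)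

lemma cs_period: "cs (k + int (2 * n)) = cs k"
proof -
  have "alt_index (k + 2 * int n + i) = alt_index (k + i)" for i by (simp add: alt_index_def)
  from this[of 0] this[of 1] show ?thesis
    using pt_period[of k] by (simp add: cs_def)
qed

lemma char_seq_Suc: "char_seq C X 1 2 (Suc k) = cs (int k)"
proof (cases "even k")
  case True
  then obtain i where "k = 2 * i" by blast
  then show ?thesis using pt_even[of i] by (simp add: char_seq_def cs_def alt_index_def)
next
  case False
  then obtain i where "k = 2 * i + 1" by (elim oddE)
  then show ?thesis using pt_odd[of i] by (simp add: char_seq_def cs_def alt_index_def add.commute)
qed

section \<open>Coordinates of the real roots along the walk\<close>

definition root :: "int \<Rightarrow> int \<Rightarrow> int ^ 2" where
  "root m k = cdet cs (m - 1) k *s simple_root (alt_index m)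
     + cdet cs m k *s simple_root (alt_index (m + 1))"

lemma root_nth [simp]:
  "root m k $ alt_index m = cdet cs (m - 1) k" "root m k $ alt_index (m + 1) = cdet cs m k"
  by (simp_all add: root_def axis_def)

lemma simple_root_eq_root:
  "simple_root (alt_index m) = root m m" "simple_root (alt_index (m + 1)) = - root m (m - 1)"
  by (simp_all add: root_def vec_eq_iff)

lemma simple_refl_nth:
  assumes "Y \<in> points C"
  shows "simple_refl C Y (alt_index m) v $ alt_index m =
      - v $ alt_index m - cmat C Y $ alt_index m $ alt_index (m + 1) * v $ alt_index (m + 1)"
    and "simple_refl C Y (alt_index m) v $ alt_index (m + 1) = v $ alt_index (m + 1)"
  using cmat_diag[OF assms]
  by (simp_all add: simple_refl_def sum_alt_index[of _ m] axis_def)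

lemma simple_refl_minus: "simple_refl C Y i (- v) = - simple_refl C Y i v"
  by (simp add: simple_refl_def sum_negf[symmetric] vec_eq_iff algebra_simps)

text \<open>A reflection is the recursion in the left argument of \<open>D\<close>: it replaces
  \<open>D(m-1,k)\<close> by \<open>D(m+1,k)\<close>, keeps \<open>D(m,k)\<close>, and thus moves
  \<open>m\<close> while the label \<open>k\<close> stays.\<close>

lemma simple_refl_root: "simple_refl C (pt m) (alt_index m) (root m k) = root (m + 1) k"
proof -
  have "root (m + 1) k $ alt_index m = cdet cs (m + 1) k"
    using root_nth(2)[of "m + 1" k] by (simp add: add.assoc)
  moreover have "root (m + 1) k $ alt_index (m + 1) = cdet cs m k"
    using root_nth(1)[of "m + 1" k] by simp
  ultimately show ?thesis
    using cs_eq[of m] cdet_rec_left[of cs m k]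
    by (simp add: vec_eq_iff forall_alt_index[of _ m] simple_refl_nth)
qed

lemma simple_refl_root_Suc: "simple_refl C (pt (m + 1)) (alt_index m) (root (m + 1) k) = root m k"
proof -
  have "root (m + 1) k $ alt_index m = cdet cs (m + 1) k"
    using root_nth(2)[of "m + 1" k] by (simp add: add.assoc)
  moreover have "root (m + 1) k $ alt_index (m + 1) = cdet cs m k"
    using root_nth(1)[of "m + 1" k] by simp
  moreover have "cmat C (pt (m + 1)) $ alt_index m $ alt_index (m + 1) = - int (cs m)"
    using cs_eq[of m] by (simp add: pt_Suc cmat_rmap)
  ultimately show ?thesis
    using cdet_rec_left[of cs m k]
    by (simp add: vec_eq_iff forall_alt_index[of _ m] simple_refl_nth)
qed

text \<open>The source index is existential because \<open>pt\<close> is periodic, so a point has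
  many indices; lifting a path of generators to the integers supplies a suitable one. Oddness is
  included because a simple root may be the negative of a labelled vector.\<close>

lemma weyl_groupoid_root:
  assumes "(Z, g, Y) \<in> weyl_groupoid C" "Z = pt m"
  shows "(\<forall>v. g (- v) = - g v) \<and> (\<exists>i. Y = pt i \<and> (\<forall>k. g (root i k) = root m k))"
  using assms
proof (induction arbitrary: m rule: weyl_groupoid.induct)
  case (ident Y)
  then show ?case by auto
next
  case (gen Y i)
  then have Y: "Y = rmap C i (pt m)" using rmap_rmap by metis
  from alt_index_cases[of i m] show ?case
  proof
    assume i: "i = alt_index m"
    then have "Y = pt (m + 1)" using Y rmap_pt by simp
    then show ?thesis using i simple_refl_minus simple_refl_root_Suc by blast
  next
    assume i: "i = alt_index (m + 1)"
    then have "Y = pt (m - 1)" using Y rmap_pt_pred by simp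
    then show ?thesis using i simple_refl_minus simple_refl_root[of "m - 1"]
      by (metis alt_index_diff diff_add_cancel)
  qed
next
  case (comp Z g Y f V)
  from comp.IH(1)[OF comp.prems] obtain i
    where g: "\<forall>v. g (- v) = - g v" "Y = pt i" "\<forall>k. g (root i k) = root m k" by blast
  from comp.IH(2)[OF g(2)] obtain j
    where f: "\<forall>v. f (- v) = - f v" "V = pt j" "\<forall>k. f (root j k) = root i k" by blast
  show ?case using f g by auto
qed

lemma weyl_groupoid_transport:
  "\<exists>w. (pt m, w, pt k) \<in> weyl_groupoid C \<and> (\<forall>v. w (- v) = - w v) \<and> (\<forall>j. w (root k j) = root m j)"
proof (induction k rule: int_induct[where k = m])
  case base
  show ?case using weyl_groupoid.ident[OF pt_in_points[of m]] by (metis id_apply)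
next
  case (step1 k)
  then obtain w where w: "(pt m, w, pt k) \<in> weyl_groupoid C" "\<forall>v. w (- v) = - w v"
    "\<forall>j. w (root k j) = root m j" by blast
  have "(pt k, simple_refl C (pt (k + 1)) (alt_index k), pt (k + 1)) \<in> weyl_groupoid C"
    using weyl_groupoid.gen[of "pt (k + 1)" C "alt_index k"] by (simp add: rmap_pt_Suc)
  from weyl_groupoid.comp[OF w(1) this] show ?case
    using w simple_refl_minus simple_refl_root_Suc
    by (metis comp_apply)
next
  case (step2 k)
  then obtain w where w: "(pt m, w, pt k) \<in> weyl_groupoid C" "\<forall>v. w (- v) = - w v"
    "\<forall>j. w (root k j) = root m j" by blast
  let ?s = "simple_refl C (pt (k - 1)) (alt_index (k - 1))"
  have "(pt k, ?s, pt (k - 1)) \<in> weyl_groupoid C"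
    using weyl_groupoid.gen[of "pt (k - 1)" C "alt_index (k - 1)"] rmap_pt[of "k - 1"] by simp
  from weyl_groupoid.comp[OF w(1) this] have "(pt m, w \<circ> ?s, pt (k - 1)) \<in> weyl_groupoid C" .
  moreover have "\<forall>v. (w \<circ> ?s) (- v) = - (w \<circ> ?s) v" using w by (simp add: simple_refl_minus)
  moreover have "\<forall>j. (w \<circ> ?s) (root (k - 1) j) = root m j"
    using w simple_refl_root[of "k - 1"] by simp
  ultimately show ?case by blast
qed

lemma real_roots_pt: "real_roots C (pt m) = range (root m) \<union> uminus ` range (root m)"
proof (intro equalityI subsetI)
  fix v assume "v \<in> real_roots C (pt m)"
  then obtain i w Y where w: "v = w (simple_root i)" "(pt m, w, Y) \<in> weyl_groupoid C"
    by (auto simp: real_roots_def)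
  obtain j where j: "\<And>v. w (- v) = - w v" "\<And>k. w (root j k) = root m k"
    using weyl_groupoid_root[OF w(2) refl] by blast
  show "v \<in> range (root m) \<union> uminus ` range (root m)"
    using alt_index_cases[of i j] simple_root_eq_root[of j] j w(1) by auto
next
  fix v assume v: "v \<in> range (root m) \<union> uminus ` range (root m)"
  have "root m k \<in> real_roots C (pt m)" for k
  proof -
    obtain w where "(pt m, w, pt k) \<in> weyl_groupoid C" "w (root k k) = root m k"
      using weyl_groupoid_transport by blast
    then show ?thesis
      unfolding real_roots_def simple_root_eq_root(1)[symmetric] mem_Collect_eq by metis
  qed
  \<comment> \<open>The negative comes from \<open>pt (k + 1)\<close>, where
    \<open>- root (k + 1) k\<close> is simple.\<close>
  moreover have "- root m k \<in> real_roots C (pt m)" for k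
  proof -
    obtain w where w: "(pt m, w, pt (k + 1)) \<in> weyl_groupoid C" "\<forall>v. w (- v) = - w v"
      "\<forall>j. w (root (k + 1) j) = root m j"
      using weyl_groupoid_transport by blast
    have "w (simple_root (alt_index (k + 1 + 1))) = - root m k"
      unfolding simple_root_eq_root(2) using w by simp
    then show ?thesis unfolding real_roots_def mem_Collect_eq using w(1) by metis
  qed
  ultimately show "v \<in> real_roots C (pt m)" using v by auto
qed

lemma root_nonneg_iff: "root m k \<in> nonneg_vecs \<longleftrightarrow> 0 \<le> cdet cs (m - 1) k \<and> 0 \<le> cdet cs m k"
  and root_nonpos_iff: "- root m k \<in> nonneg_vecs \<longleftrightarrow> cdet cs (m - 1) k \<le> 0 \<and> cdet cs m k \<le> 0"
  by (simp_all add: nonneg_vecs_def forall_alt_index[of _ m])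

section \<open>Cartan graphs and half periods\<close>

lemma cdet_coherent:
  assumes "cartan_graph C"
  shows "0 \<le> cdet cs (m - 1) k * cdet cs m k"
proof -
  have "root m k \<in> pos_roots C (pt m) \<union> neg_roots C (pt m)"
    using assms real_roots_pt[of m] by (auto simp: cartan_graph_def)
  then have "root m k \<in> nonneg_vecs \<or> - root m k \<in> nonneg_vecs"
    by (auto simp: pos_roots_def neg_roots_def)
  then show ?thesis unfolding root_nonneg_iff root_nonpos_iff by (auto simp: zero_le_mult_iff)
qed

lemma finite_cdet:
  assumes "finite_graph C"
  shows "finite (range (\<lambda>k. (cdet cs (-1) k, cdet cs 0 k)))"
proof -
  have "finite (range (root 0))"
    using assms real_roots_pt[of 0] base_point by (metis finite_graph_def finite_Un pt_0)
  then have "finite ((\<lambda>v. (v $ alt_index 0, v $ alt_index 1)) ` range (root 0))" by simp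
  moreover have "(\<lambda>v. (v $ alt_index 0, v $ alt_index 1)) ` range (root 0)
      = range (\<lambda>k. (cdet cs (-1) k, cdet cs 0 k))"
    using root_nth[of 0] by (simp add: image_image)
  ultimately show ?thesis by simp
qed

text \<open>Equal coordinates force \<open>D(j,k) = 0\<close>, but \<open>D\<close> does not vanish
  on distinct indices of the window.\<close>

lemma inj_on_root:
  assumes hp: "half_period cs N"
  shows "inj_on (root m) {m..<m + int N}"
proof (rule inj_onI)
  fix j k assume jk: "j \<in> {m..<m + int N}" "k \<in> {m..<m + int N}" "root m j = root m k"
  have "cdet cs (m - 1) j = cdet cs (m - 1) k" "cdet cs m j = cdet cs m k"
    using jk(3) root_nth[of m] by metis+
  then have "cdet cs j k = 0"
    using cdet_pluecker[of cs "m - 1" m j k] by simp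
  moreover have "0 < cdet cs j k" if "j < k" using half_period_cdet_pos[OF hp that] jk by simp
  moreover have "0 < cdet cs k j" if "k < j" using half_period_cdet_pos[OF hp that] jk by simp
  ultimately show "j = k" using cdet_antisym[of cs k j] by (metis linorder_neqE less_irrefl minus_zero)
qed

lemma root_half_period:
  assumes hp: "half_period cs N"
  shows "\<exists>i\<in>{m..<m + int N}. root m k = root m i \<or> root m k = - root m i"
  using half_period_cdet_coherent[OF hp, of m k] by (auto simp: vec_eq_iff forall_alt_index[of _ m])

lemma root_pos:
  assumes hp: "half_period cs N" and "i \<in> {m..<m + int N}"
  shows "root m i \<in> nonneg_vecs"
  unfolding root_nonneg_iff
  using half_period_cdet_nonneg[OF hp, of m i] half_period_cdet_nonneg[OF hp, of "m - 1" i] assms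
  by simp

lemma root_nonzero: "root m k \<noteq> 0"
proof
  assume "root m k = 0"
  then have "cdet cs (m - 1) k = 0" "cdet cs m k = 0"
    using root_nth[of m k] by simp_all
  then show False using cdet_pluecker[of cs "m - 1" m k "k + 1"] by simp
qed

lemma pos_roots_pt:
  assumes hp: "half_period cs N"
  shows "pos_roots C (pt m) = root m ` {m..<m + int N}"
proof (intro equalityI subsetI)
  fix v assume "v \<in> root m ` {m..<m + int N}"
  then show "v \<in> pos_roots C (pt m)"
    using root_pos[OF hp] by (auto simp: pos_roots_def real_roots_pt)
next
  fix v assume "v \<in> pos_roots C (pt m)"
  then have v: "v \<in> real_roots C (pt m)" "v \<in> nonneg_vecs" by (auto simp: pos_roots_def)
  then obtain k where "v = root m k \<or> v = - root m k" by (auto simp: real_roots_pt)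
  then obtain i where i: "i \<in> {m..<m + int N}" "v = root m i \<or> v = - root m i"
    using root_half_period[OF hp, of m k] by auto
  have "v = 0" if "v = - root m i"
    using root_pos[OF hp i(1)] v(2) that
    by (auto simp: nonneg_vecs_def vec_eq_iff intro: antisym)
  then show "v \<in> root m ` {m..<m + int N}" using i root_nonzero[of m i] by auto
qed

lemma card_pos_roots_pt:
  assumes hp: "half_period cs N"
  shows "finite (pos_roots C (pt m))" "card (pos_roots C (pt m)) = N"
  using pos_roots_pt[OF hp, of m] card_image[OF inj_on_root[OF hp, of m]] by simp_all

lemma plane_roots_eq:
  assumes "i \<noteq> j"
  shows "plane_roots C Y i j = pos_roots C Y"
proof -
  have ij: "i = j \<or> k = i \<or> k = j" for k :: 2
    using exhaust_2[of i] exhaust_2[of j] exhaust_2[of k] by auto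
  have "v \<in> {int a *s simple_root i + int b *s simple_root j | a b. True} \<longleftrightarrow> v \<in> nonneg_vecs" for v
  proof
    assume "v \<in> {int a *s simple_root i + int b *s simple_root j | a b. True}"
    then show "v \<in> nonneg_vecs" by (auto simp: nonneg_vecs_def axis_def)
  next
    assume v: "v \<in> nonneg_vecs"
    have "v = int (nat (v $ i)) *s simple_root i + int (nat (v $ j)) *s simple_root j"
      unfolding vec_eq_iff
    proof
      fix k
      show "v $ k = (int (nat (v $ i)) *s simple_root i + int (nat (v $ j)) *s simple_root j) $ k"
        using ij[of k] assms v by (auto simp: nonneg_vecs_def axis_def)
    qed
    then show "v \<in> {int a *s simple_root i + int b *s simple_root j | a b. True}" by blast
  qed
  then show ?thesis by (auto simp: plane_roots_def pos_roots_def)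
qed

lemma t_num_pt:
  assumes "half_period cs N" "i \<noteq> j"
  shows "t_num C (pt m) i j = enat N"
  using card_pos_roots_pt[OF assms(1), of m] by (simp add: t_num_def plane_roots_eq[OF assms(2)])

lemma rmap_comp_funpow_pt:
  "((rmap C (alt_index (m + 1)) \<circ> rmap C (alt_index m)) ^^ k) (pt m) = pt (m + 2 * int k)"
  "((rmap C (alt_index m) \<circ> rmap C (alt_index (m + 1))) ^^ k) (pt m) = pt (m - 2 * int k)"
proof -
  have e: "alt_index (m + 2 * int k) = alt_index m" "alt_index (m - 2 * int k) = alt_index m"
    "alt_index (m + 2 * int k + 1) = alt_index (m + 1)" "alt_index (m - 2 * int k + 1) = alt_index (m + 1)" for k
    by (simp_all add: alt_index_def)
  show "((rmap C (alt_index (m + 1)) \<circ> rmap C (alt_index m)) ^^ k) (pt m) = pt (m + 2 * int k)"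
  proof (induction k)
    case (Suc k)
    then show ?case
      using rmap_pt[of "m + 2 * int k"] rmap_pt[of "m + 2 * int k + 1"] e by (simp add: algebra_simps)
  qed simp
  show "((rmap C (alt_index m) \<circ> rmap C (alt_index (m + 1))) ^^ k) (pt m) = pt (m - 2 * int k)"
  proof (induction k)
    case (Suc k)
    have "rmap C (alt_index m) (pt (m - 2 * int k - 1)) = pt (m - 2 * int k - 2)"
      using rmap_pt_pred[of "m - 2 * int k - 1"] e[of k] by simp
    then show ?case
      using Suc rmap_pt_pred[of "m - 2 * int k"] e[of k] by (simp add: algebra_simps)
  qed simp
qed

text \<open>For \<open>i\<close> and \<open>j\<close> distinct, the map with exponent
  \<open>t = N\<close> moves the index by \<open>2N\<close>, a multiple of the period
  \<open>2n\<close> since \<open>n\<close> divides \<open>N\<close>. Finiteness and signs come from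
  the window.\<close>

lemma cartan_graph_if_half_period:
  assumes hp: "half_period cs N" and "n dvd N"
  shows "cartan_graph C" "finite_graph C"
proof -
  have fin: "finite (real_roots C (pt m))" for m
  proof -
    have "range (root m) \<subseteq> root m ` {m..<m + int N} \<union> uminus ` root m ` {m..<m + int N}"
      using root_half_period[OF hp, of m] by auto
    then have "finite (range (root m))" by (rule finite_subset) simp
    then show ?thesis by (simp add: real_roots_pt)
  qed
  then show "finite_graph C" using points_eq_pt by (metis finite_graph_def)
  have roots: "real_roots C (pt m) = pos_roots C (pt m) \<union> neg_roots C (pt m)" for m
  proof -
    have "v \<in> nonneg_vecs \<or> v \<in> uminus ` nonneg_vecs" if "v \<in> real_roots C (pt m)" for v
    proof -
      obtain k where "v = root m k \<or> v = - root m k" using \<open>v \<in> real_roots C (pt m)\<close> by (auto simp: real_roots_pt)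
      then obtain i where "i \<in> {m..<m + int N}" "v = root m i \<or> v = - root m i"
        using root_half_period[OF hp, of m k] by auto
      then show ?thesis using root_pos[OF hp] by auto
    qed
    then show ?thesis by (auto simp: pos_roots_def neg_roots_def)
  qed
  have per: "pt (m + 2 * int N) = pt m" "pt (m - 2 * int N) = pt m" for m
  proof -
    obtain q where "N = n * q" using \<open>n dvd N\<close> by blast
    then show "pt (m + 2 * int N) = pt m" "pt (m - 2 * int N) = pt m"
      using pt_period_mult[of m "int q"] pt_period_mult[of m "- int q"] by (simp_all add: algebra_simps)
  qed
  have cyc: "((rmap C i \<circ> rmap C j) ^^ the_enat (t_num C (pt m) i j)) (pt m) = pt m" for i j m
  proof (cases "i = j")
    case True
    have "((rmap C j \<circ> rmap C j) ^^ k) (pt m) = pt m" for k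
      by (induction k) (simp_all add: rmap_rmap)
    then show ?thesis using True by simp
  next
    case False
    then consider "i = alt_index (m + 1)" "j = alt_index m" | "i = alt_index m" "j = alt_index (m + 1)"
      using alt_index_cases by metis
    then show ?thesis
      using t_num_pt[OF hp False, of m] rmap_comp_funpow_pt[where m = m and k = N] per[of m] by cases simp_all
  qed
  show "cartan_graph C"
    unfolding cartan_graph_def using graph roots cyc points_eq_pt by metis
qed

lemma half_period_if_cartan_graph:
  assumes "cartan_graph C" "finite_graph C"
  shows "\<exists>N. half_period cs N"
  using half_period_exists[OF cs_period _ finite_cdet cdet_coherent] assms n_pos by simp

end

section \<open>Comparison of the periods \<open>N\<close> and \<open>2n\<close>\<close>

lemma sum_periodic_mult:
  fixes f :: "nat \<Rightarrow> int"
  assumes "\<And>k. f (k + p) = f k"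
  shows "(\<Sum>k<q * p. f k) = int q * (\<Sum>k<p. f k)"
proof (induction q)
  case (Suc q)
  have "f (k + q * p) = f k" for k
  proof (induction q)
    case (Suc q)
    then show ?case using assms[of "k + q * p"] by (simp add: ac_simps)
  qed simp
  moreover have "(\<Sum>k<Suc q * p. f k) = (\<Sum>k<q * p. f k) + (\<Sum>k<p. f (k + q * p))"
    using sum.atLeastLessThan_concat[of 0 "q * p" "Suc q * p" f]
      sum.shift_bounds_nat_ivl[of f 0 "q * p" p]
    by (simp add: atLeast0LessThan add.commute)
  ultimately show ?case using Suc by (simp add: algebra_simps)
qed simp

theorem theorem4p15:
  fixes C :: "(2, 'x) graph_data" and X :: 'x and n :: nat and c :: "nat \<Rightarrow> nat" and l :: int
  assumes "semi_cartan_graph C" and "connected_graph C" and "finite (points C)"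
    and "X \<in> points C"
    and "0 < n" and "((rmap C 2 \<circ> rmap C 1) ^^ n) X = X"
    and "\<And>m. 0 < m \<Longrightarrow> ((rmap C 2 \<circ> rmap C 1) ^^ m) X = X \<Longrightarrow> n \<le> m"
    and "c = char_seq C X 1 2"
    and "l = 6 * int n - (\<Sum>i = 1..2 * n. int (c i))"
  shows "((cartan_graph C \<and> finite_graph C) \<longleftrightarrow>
      (l > 0 \<and> l dvd 12 \<and>
       map c [1..<12 * n div nat l + 1] \<in> A_plus \<and>
       (\<forall>k\<ge>1. c k = periodic_seq (map c [1..<12 * n div nat l + 1]) k))) \<and>
    (cartan_graph C \<and> finite_graph C \<longrightarrow>
      12 * n div nat l = card (pos_roots C X) \<and> enat (card (pos_roots C X)) = t_num C X 1 2)"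
proof -
  interpret rank_two_graph C X n by unfold_locales (fact assms)+
  have c: "c (Suc k) = cs (int k)" for k using char_seq_Suc assms(8) by simp
  have map_c: "map c [1..<N + 1] = map (\<lambda>k. cs (int k)) [0..<N]" for N
    by (simp add: map_Suc_upt[symmetric] c del: upt_Suc)
  have l: "l = 6 * int n - (\<Sum>k<2 * n. int (cs (int k)))"
    unfolding assms(9) by (simp add: sum.atLeast1_atMost_eq c)
  have periodic: "periodic_seq (map c [1..<N + 1]) (Suc k) = cs (int (k mod N))" if "0 < N" for k N
    using that unfolding map_c by (simp add: periodic_seq_def)
  \<comment> \<open>By minimality of \<open>n\<close>, the remainder of \<open>m\<close> modulo
    \<open>n\<close>, again a number of rounds returning to \<open>X\<close>, is 0.\<close>
  have n_dvd: "n dvd m" if "((rmap C 2 \<circ> rmap C 1) ^^ m) X = X" for m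
    using assms(7)[of "m mod n"] funpow_mod_n[of m] that n_pos
    by (metis dvd_eq_mod_eq_0 gr0I mod_less_divisor not_le)
  have main: "0 < l \<and> l dvd 12 \<and> 12 * n div nat l = N"
    if hp: "half_period cs N" and cg: "cartan_graph C" for N
  proof -
    have t: "t_num C X 2 1 = enat N" using t_num_pt[OF hp, of 2 1 0] by simp
    then have "((rmap C 2 \<circ> rmap C 1) ^^ N) X = X"
      using cg base_point unfolding cartan_graph_def by (metis enat_ord_simps(4) the_enat.simps enat.distinct(1))
    then have "n dvd N" by (rule n_dvd)
    then obtain q where q: "N = n * q" by blast
    have "(\<Sum>k<N. int (cs (int k))) + 6 = 3 * int N"
    proof -
      have "sum_list (map (\<lambda>k. cs (int k)) [0..<N]) + 6 = 3 * N"
        using A_plus_sum_list[OF half_period_A_plus[OF hp]] by simp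
      then have "(\<Sum>k<N. cs (int k)) + 6 = 3 * N"
        by (simp add: interv_sum_list_conv_sum_set_nat atLeast0LessThan)
      then have "int ((\<Sum>k<N. cs (int k)) + 6) = int (3 * N)" by (rule arg_cong)
      then show ?thesis by simp
    qed
    \<comment> \<open>Summing over the common period \<open>2nN\<close> in two ways yields
      \<open>N l = 12 n\<close>.\<close>
    moreover have "(\<Sum>k<2 * n * N. int (cs (int k))) = int (2 * n) * (\<Sum>k<N. int (cs (int k)))"
      using half_period_periodic[OF hp] by (intro sum_periodic_mult) simp
    moreover have "(\<Sum>k<N * (2 * n). int (cs (int k))) = int N * (\<Sum>k<2 * n. int (cs (int k)))"
      using cs_period by (intro sum_periodic_mult) simp
    ultimately have "int N * (6 * int n - l) = 2 * int n * (3 * int N - 6)"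
      by (simp add: l mult.commute[of "2 * n" N])
    then have "int N * l = 12 * int n" by (simp add: algebra_simps)
    then have ql: "int q * l = 12" using n_pos q by simp
    then have "0 < l" by (metis zero_less_mult_iff of_nat_less_0_iff zero_less_numeral)
    moreover have "l dvd 12" using ql by (metis dvd_triv_right)
    moreover have "12 * n div nat l = N"
    proof -
      have "q * nat l = 12" using ql \<open>0 < l\<close> by (metis nat_int nat_mult_distrib nat_numeral of_nat_0_le_iff)
      then have "12 * n = N * nat l" using q by (metis mult.assoc mult.commute)
      then show ?thesis using \<open>0 < l\<close> by simp
    qed
    ultimately show "0 < l \<and> l dvd 12 \<and> 12 * n div nat l = N" by blast
  qed
  show ?thesis
  proof (intro conjI impI iffI)
    assume "cartan_graph C \<and> finite_graph C"
    then obtain N where hp: "half_period cs N" and cg: "cartan_graph C"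
      using half_period_if_cartan_graph by blast
    note m = main[OF hp cg]
    show "l > 0" "l dvd 12" using m by auto
    show "map c [1..<12 * n div nat l + 1] \<in> A_plus"
      using half_period_A_plus[OF hp] m by (simp only: map_c)
    have N: "0 < N" using hp by (simp add: half_period_def)
    show "\<forall>k\<ge>1. c k = periodic_seq (map c [1..<12 * n div nat l + 1]) k"
    proof (intro allI impI)
      fix k :: nat assume "1 \<le> k"
      then obtain j where j: "k = Suc j" by (cases k) auto
      have "cs (int (j mod N) + int (j div N) * int N) = cs (int (j mod N))"
        using half_period_periodic[OF hp] by (rule periodic_mult)
      then have "cs (int j) = cs (int (j mod N))"
        by (metis add.commute div_mult_mod_eq of_nat_add of_nat_mult)
      then show "c k = periodic_seq (map c [1..<12 * n div nat l + 1]) k"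
        using m periodic[OF N, of j] j c by simp
    qed
    show "12 * n div nat l = card (pos_roots C X)"
      using m card_pos_roots_pt[OF hp, of 0] by simp
    show "enat (card (pos_roots C X)) = t_num C X 1 2"
      using t_num_pt[OF hp, of 1 2 0] card_pos_roots_pt[OF hp, of 0] by simp
  next
    assume R: "l > 0 \<and> l dvd 12 \<and> map c [1..<12 * n div nat l + 1] \<in> A_plus \<and>
       (\<forall>k\<ge>1. c k = periodic_seq (map c [1..<12 * n div nat l + 1]) k)"
    define N where "N = 12 * n div nat l"
    have A: "map (\<lambda>k. cs (int k)) [0..<N] \<in> A_plus" using R by (simp only: map_c N_def)
    \<comment> \<open>The sum formula for \<open>A_plus\<close> excludes the empty list.\<close>
    have N: "0 < N" using A_plus_sum_list[OF A] by (cases "N = 0") auto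
    have "nat l dvd 12" using R by (metis int_dvd_int_iff nat_0_le of_nat_numeral order_less_imp_le)
    then have "n dvd N" unfolding N_def by (metis div_mult_swap dvd_triv_left mult.commute)
    have mod: "cs (int k) = cs (int (k mod N))" for k
      using R periodic[OF N, of k] c[of k] unfolding N_def[symmetric] by simp
    \<comment> \<open>So far \<open>N\<close>-periodicity holds on natural indices only; the period
      \<open>2n\<close> carries it to negative ones.\<close>
    have "cs (m + int N) = cs m" for m
    proof -
      obtain k s where k: "m + s * (2 * int n) = int k" by (rule nonneg_representative)
      have sh: "cs (i + s * (2 * int n)) = cs i" for i
        using periodic_mult[of cs "int (2 * n)" i s] cs_period by simp
      have "cs (int (k + N)) = cs (int k)" using mod[of k] mod[of "k + N"] by simp
      moreover have "m + int N + s * (2 * int n) = int (k + N)" using k by simp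
      ultimately show ?thesis using sh[of m] sh[of "m + int N"] k by metis
    qed
    with A have "half_period cs N" by (rule A_plus_half_period)
    then show "cartan_graph C" "finite_graph C"
      using cartan_graph_if_half_period \<open>n dvd N\<close> by blast+
  qed
qed

end
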